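(* Let $(\mathcal{T},\leq)$ be a rooted non-metric tree and let $\Psi:\mathcal{T}\to[1,\infty]$ be an (increasing) parametrization of $\mathcal{T}$. Then the weak tree topology on $\mathcal{T}$ is coarser than or equal to the topology associated with the metric $d_\Psi$.
   Context: A rooted non-metric tree is a poset $(\mathcal{T},\leq)$ such that: (T1) there exists a (unique) smallest element $\tau_0\in\mathcal{T}$; (T2) every set of the form $I_\tau=\{\sigma\in\mathcal{T}\mid\sigma\leq\tau\}$ is isomorphic, as an ordered set, to a real interval; (T3) every totally ordered convex subset of $\mathcal{T}$ is isomorphic to a real interval; (T4) every non-empty subset of $\mathcal{T}$ has an infimum in $\mathcal{T}$. The infimum of $\{\tau,\sigma\}$ is written $\tau\wedge\sigma$. For $\tau,\sigma\in\mathcal{T}$ the closed segment is $[\tau,\sigma]=\{\alpha\in\mathcal{T}\mid \tau\wedge\sigma\leq\alpha\leq\tau \text{ or } \tau\wedge\sigma\leq\alpha\leq\sigma\}$, and $]\tau,\sigma]=[\tau,\sigma]\setminus\{\tau\}$. For $\tau\in\mathcal{T}$, define an equivalence relation on $\mathcal{T}\setminus\{\tau\}$ by $\sigma\sim_\tau\alpha$ if and only if $]\tau,\sigma]\cap]\tau,\alpha]\neq\emptyset$. The equivalence class of $\sigma$ is denoted $[\sigma]_\tau\subseteq\mathcal{T}\setminus\{\tau\}$ and is called a tangent vector at $\tau$. The weak tree topology on $\mathcal{T}$ is the topology generated by all tangent vectors, i.e. its open sets are the unions of finite intersections of sets of the form $[\sigma]_\tau$ (with $\tau\in\mathcal{T}$,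 $\sigma\in\mathcal{T}\setminus\{\tau\}$). An (increasing) parametrization of $\mathcal{T}$ is an increasing map $\Psi:\mathcal{T}\to[-\infty,\infty]$ whose restriction to every totally ordered convex subset of $\mathcal{T}$ is an isomorphism of ordered sets onto a (possibly extended) real interval. For an increasing parametrization $\Psi:\mathcal{T}\to[1,\infty]$, the metric $d_\Psi$ is defined by $$d_\Psi(\tau,\sigma)=\left(\frac{1}{\Psi(\tau\wedge\sigma)}-\frac{1}{\Psi(\tau)}\right)+\left(\frac{1}{\Psi(\tau\wedge\sigma)}-\frac{1}{\Psi(\sigma)}\right),$$ with the convention $1/\infty=0$. *)

theory Defs
  imports "HOL-Analysis.Analysis"
begin

definition order_iso_betw :: "('a::order \<Rightarrow> 'b::order) \<Rightarrow> 'a set \<Rightarrow> 'b set \<Rightarrow> bool" where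
  "order_iso_betw f A B \<longleftrightarrow> bij_betw f A B \<and> (\<forall>x\<in>A. \<forall>y\<in>A. x \<le> y \<longleftrightarrow> f x \<le> f y)"

definition order_convex_in :: "'a::order set \<Rightarrow> 'a set \<Rightarrow> bool" where
  "order_convex_in X S \<longleftrightarrow> S \<subseteq> X \<and> (\<forall>x\<in>S. \<forall>y\<in>S. \<forall>z\<in>X. x \<le> z \<and> z \<le> y \<longrightarrow> z \<in> S)"

definition is_infimum_in :: "'a::order set \<Rightarrow> 'a set \<Rightarrow> 'a \<Rightarrow> bool" where
  "is_infimum_in X S m \<longleftrightarrow>
     m \<in> X \<and> (\<forall>s\<in>S. m \<le> s) \<and> (\<forall>b\<in>X. (\<forall>s\<in>S. b \<le> s) \<longrightarrow> b \<le> m)"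

text \<open>
  A tree is a set \<open>T\<close> with the order induced from its ambient type.
  The predicate \<^const>\<open>is_interval\<close> on the reals admits degenerate intervals; this is
  needed, since the initial segment of the root is a singleton.
\<close>

definition rooted_nonmetric_tree :: "'a::order set \<Rightarrow> bool" where
  "rooted_nonmetric_tree T \<longleftrightarrow>
     (\<exists>\<tau>0\<in>T. \<forall>\<tau>\<in>T. \<tau>0 \<le> \<tau>) \<and>
     (\<forall>\<tau>\<in>T. \<exists>f J. is_interval (J :: real set) \<and> order_iso_betw f {\<sigma>\<in>T. \<sigma> \<le> \<tau>} J) \<and>
     (\<forall>S. order_convex_in T S \<and> Complete_Partial_Order.chain (\<le>) S \<longrightarrow>
        (\<exists>f J. is_interval (J :: real set) \<and> order_iso_betw f S J)) \<and>
     (\<forall>S. S \<subseteq> T \<and> S \<noteq> {} \<longrightarrow> (\<exists>m. is_infimum_in T S m))"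

definition tree_meet :: "'a::order set \<Rightarrow> 'a \<Rightarrow> 'a \<Rightarrow> 'a" where
  "tree_meet T \<tau> \<sigma> = (THE m. is_infimum_in T {\<tau>, \<sigma>} m)"

definition tree_segment :: "'a::order set \<Rightarrow> 'a \<Rightarrow> 'a \<Rightarrow> 'a set" where
  "tree_segment T \<tau> \<sigma> =
     {\<alpha>\<in>T. (tree_meet T \<tau> \<sigma> \<le> \<alpha> \<and> \<alpha> \<le> \<tau>) \<or> (tree_meet T \<tau> \<sigma> \<le> \<alpha> \<and> \<alpha> \<le> \<sigma>)}"

definition tangent_rel :: "'a::order set \<Rightarrow> 'a \<Rightarrow> 'a rel" where
  "tangent_rel T \<tau> =
     {(\<sigma>, \<alpha>). \<sigma> \<in> T - {\<tau>} \<and> \<alpha> \<in> T - {\<tau>} \<and>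
        (tree_segment T \<tau> \<sigma> - {\<tau>}) \<inter> (tree_segment T \<tau> \<alpha> - {\<tau>}) \<noteq> {}}"

definition tangent_vector :: "'a::order set \<Rightarrow> 'a \<Rightarrow> 'a \<Rightarrow> 'a set" where
  "tangent_vector T \<tau> \<sigma> = tangent_rel T \<tau> `` {\<sigma>}"

text \<open>
  The empty intersection is \<open>T\<close>, so that \<open>T\<close> is open also for the one-point tree, which has
  no tangent vectors.
\<close>

definition weak_tree_topology :: "'a::order set \<Rightarrow> 'a topology" where
  "weak_tree_topology T = topology (arbitrary union_of (finite intersection_of
     (\<lambda>V. \<exists>\<tau>\<in>T. \<exists>\<sigma>\<in>T - {\<tau>}. V = tangent_vector T \<tau> \<sigma>) relative_to T))"

lemma topspace_weak_tree_topology: "topspace (weak_tree_topology T) = T"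
  unfolding weak_tree_topology_def by (rule topspace_subbase)

definition parametrization :: "'a::order set \<Rightarrow> ('a \<Rightarrow> ereal) \<Rightarrow> bool" where
  "parametrization T \<Psi> \<longleftrightarrow>
     mono_on T \<Psi> \<and>
     (\<forall>S. order_convex_in T S \<and> Complete_Partial_Order.chain (\<le>) S \<longrightarrow>
        (\<exists>J. order_convex_in UNIV J \<and> order_iso_betw \<Psi> S J))"

text \<open>
  For extended reals \<open>1 / \<infinity> = 0\<close>.  The value off \<open>T\<close> is irrelevant; it is set to \<open>0\<close> because
  \<^locale>\<open>Metric_space\<close> asks for nonnegativity and symmetry on the whole type.
\<close>

definition tree_dist :: "'a::order set \<Rightarrow> ('a \<Rightarrow> ereal) \<Rightarrow> 'a \<Rightarrow> 'a \<Rightarrow> real" where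
  "tree_dist T \<Psi> \<tau> \<sigma> =
     (if \<tau> \<in> T \<and> \<sigma> \<in> T then
        real_of_ereal ((1 / \<Psi> (tree_meet T \<tau> \<sigma>) - 1 / \<Psi> \<tau>) +
                       (1 / \<Psi> (tree_meet T \<tau> \<sigma>) - 1 / \<Psi> \<sigma>))
      else 0)"

lemma is_infimum_in_tree_meet:
  assumes "rooted_nonmetric_tree T" "\<tau> \<in> T" "\<sigma> \<in> T"
  shows "is_infimum_in T {\<tau>, \<sigma>} (tree_meet T \<tau> \<sigma>)"
proof -
  have "{\<tau>, \<sigma>} \<subseteq> T" "{\<tau>, \<sigma>} \<noteq> {}" using assms by auto
  then obtain m where m: "is_infimum_in T {\<tau>, \<sigma>} m"
    using assms(1) unfolding rooted_nonmetric_tree_def by blast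
  moreover have "n = m" if "is_infimum_in T {\<tau>, \<sigma>} n" for n
    using m that unfolding is_infimum_in_def by (meson order_antisym)
  ultimately show ?thesis unfolding tree_meet_def by (rule theI)
qed

lemma tree_meet_in:
  assumes "rooted_nonmetric_tree T" "\<tau> \<in> T" "\<sigma> \<in> T"
  shows "tree_meet T \<tau> \<sigma> \<in> T" "tree_meet T \<tau> \<sigma> \<le> \<tau>" "tree_meet T \<tau> \<sigma> \<le> \<sigma>"
  using is_infimum_in_tree_meet[OF assms] by (auto simp: is_infimum_in_def)

lemma tree_meet_greatest:
  assumes "rooted_nonmetric_tree T" "\<tau> \<in> T" "\<sigma> \<in> T" "\<beta> \<in> T" "\<beta> \<le> \<tau>" "\<beta> \<le> \<sigma>"
  shows "\<beta> \<le> tree_meet T \<tau> \<sigma>"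
  using is_infimum_in_tree_meet[OF assms(1-3)] assms(4-) by (auto simp: is_infimum_in_def)

lemma tree_below_linear:
  assumes "rooted_nonmetric_tree T" "\<tau> \<in> T" "x \<in> T" "y \<in> T" "x \<le> \<tau>" "y \<le> \<tau>"
  shows "x \<le> y \<or> y \<le> x"
proof -
  obtain f and J :: "real set" where "order_iso_betw f {\<sigma>\<in>T. \<sigma> \<le> \<tau>} J"
    using assms(1,2) unfolding rooted_nonmetric_tree_def by blast
  then have "x \<le> y \<longleftrightarrow> f x \<le> f y" "y \<le> x \<longleftrightarrow> f y \<le> f x"
    using assms(3-) by (auto simp: order_iso_betw_def)
  then show ?thesis by linarith
qed

lemma parametrization_inj:
  assumes T: "rooted_nonmetric_tree T" and P: "parametrization T \<Psi>"
    and xy: "x \<in> T" "y \<in> T" "x \<le> y" "\<Psi> x = \<Psi> y"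
  shows "x = y"
proof -
  let ?S = "{z\<in>T. x \<le> z \<and> z \<le> y}"
  have "order_convex_in T ?S"
    unfolding order_convex_in_def by (auto intro: order_trans)
  moreover have "Complete_Partial_Order.chain (\<le>) ?S"
    unfolding Complete_Partial_Order.chain_def using tree_below_linear[OF T xy(2)] by blast
  ultimately obtain J where "order_iso_betw \<Psi> ?S J"
    using P unfolding parametrization_def by blast
  then have "inj_on \<Psi> ?S" by (simp add: order_iso_betw_def bij_betw_def)
  moreover have "x \<in> ?S" "y \<in> ?S" using xy by auto
  ultimately show ?thesis using xy(4) by (meson inj_onD)
qed

lemma ereal_inverse_ge1:
  fixes x :: ereal
  assumes "1 \<le> x"
  shows "1 / x = ereal (real_of_ereal (1 / x))"
  using assms by (cases x) (auto simp: one_ereal_def)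

lemma ereal_inverse_antimono_ge1:
  fixes x y :: ereal
  assumes "1 \<le> x" "x \<le> y"
  shows "real_of_ereal (1 / y) \<le> real_of_ereal (1 / x)"
  using assms by (cases x; cases y) (auto simp: one_ereal_def field_simps)

lemma ereal_inverse_inj_ge1:
  fixes x y :: ereal
  assumes "1 \<le> x" "1 \<le> y" "real_of_ereal (1 / x) = real_of_ereal (1 / y)"
  shows "x = y"
  using assms by (cases x; cases y) (auto simp: one_ereal_def field_simps)

lemma tree_dist_eq:
  assumes "rooted_nonmetric_tree T" "\<Psi> ` T \<subseteq> {1..\<infinity>}" "x \<in> T" "y \<in> T"
  shows "tree_dist T \<Psi> x y =
     2 * real_of_ereal (1 / \<Psi> (tree_meet T x y)) - real_of_ereal (1 / \<Psi> x) - real_of_ereal (1 / \<Psi> y)"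
proof -
  have "1 \<le> \<Psi> (tree_meet T x y)" "1 \<le> \<Psi> x" "1 \<le> \<Psi> y"
    using assms tree_meet_in[OF assms(1,3,4)] by auto
  then obtain a b c where abc: "1 / \<Psi> (tree_meet T x y) = ereal a" "1 / \<Psi> x = ereal b" "1 / \<Psi> y = ereal c"
    by (meson ereal_inverse_ge1)
  show ?thesis using assms(3,4) unfolding tree_dist_def abc by simp
qed

lemma Metric_space_tree_dist:
  assumes T: "rooted_nonmetric_tree T" and P: "parametrization T \<Psi>" and ge1: "\<Psi> ` T \<subseteq> {1..\<infinity>}"
  shows "Metric_space T (tree_dist T \<Psi>)"
proof -
  define r where "r \<equiv> \<lambda>x. real_of_ereal (1 / \<Psi> x)"
  have d: "tree_dist T \<Psi> x y = 2 * r (tree_meet T x y) - r x - r y" if "x \<in> T" "y \<in> T" for x y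
    using tree_dist_eq[OF T ge1 that] by (simp add: r_def)
  note m = tree_meet_in[OF T]
  have anti: "r y \<le> r x" if "x \<in> T" "y \<in> T" "x \<le> y" for x y
    unfolding r_def using that ge1 P
    by (intro ereal_inverse_antimono_ge1) (auto simp: parametrization_def mono_on_def)
  have inj: "x = y" if "x \<in> T" "y \<in> T" "x \<le> y" "r x = r y" for x y
  proof -
    have "1 \<le> \<Psi> x" "1 \<le> \<Psi> y" using that ge1 by auto
    then have "\<Psi> x = \<Psi> y" using that(4) unfolding r_def by (rule ereal_inverse_inj_ge1)
    with that show ?thesis using parametrization_inj[OF T P] by blast
  qed
  have bnd: "r x \<le> r (tree_meet T x y)" "r y \<le> r (tree_meet T x y)" if "x \<in> T" "y \<in> T" for x y
    using anti[OF m(1)[OF that] that(1) m(2)[OF that]] anti[OF m(1)[OF that] that(2) m(3)[OF that]]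
    by blast+
  have comm: "tree_meet T x y = tree_meet T y x" for x y
    unfolding tree_meet_def by (subst insert_commute) (rule refl)
  show ?thesis
  proof
    fix x y
    show "0 \<le> tree_dist T \<Psi> x y"
    proof (cases "x \<in> T \<and> y \<in> T")
      case True then show ?thesis using d[of x y] bnd[of x y] by auto
    qed (auto simp: tree_dist_def)
    show "tree_dist T \<Psi> x y = tree_dist T \<Psi> y x"
    proof (cases "x \<in> T \<and> y \<in> T")
      case True
      then have "tree_dist T \<Psi> x y = 2 * r (tree_meet T x y) - r x - r y"
        and "tree_dist T \<Psi> y x = 2 * r (tree_meet T y x) - r y - r x" using d by blast+
      moreover have "r (tree_meet T x y) = r (tree_meet T y x)" by (rule arg_cong[OF comm])
      ultimately show ?thesis by linarith
    qed (auto simp: tree_dist_def)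
  next
    fix x y assume xy: "x \<in> T" "y \<in> T"
    show "tree_dist T \<Psi> x y = 0 \<longleftrightarrow> x = y"
    proof
      assume "tree_dist T \<Psi> x y = 0"
      then have "r (tree_meet T x y) = r x" "r (tree_meet T x y) = r y"
        using d[OF xy] bnd[OF xy] by linarith+
      then have "tree_meet T x y = x" "tree_meet T x y = y"
        using inj[OF m(1)[OF xy] xy(1) m(2)[OF xy]] inj[OF m(1)[OF xy] xy(2) m(3)[OF xy]] by blast+
      then show "x = y" by simp
    next
      assume "x = y"
      moreover have "tree_meet T x x = x"
        using m[OF xy(1,1)] tree_meet_greatest[OF T xy(1,1,1)] by (simp add: order_antisym)
      ultimately show "tree_dist T \<Psi> x y = 0" using d[OF xy] by simp
    qed
  next
    fix x y z assume xyz: "x \<in> T" "y \<in> T" "z \<in> T"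
    let ?a = "tree_meet T x y" and ?b = "tree_meet T y z" and ?c = "tree_meet T x z"
    have "?a \<le> ?b \<or> ?b \<le> ?a"
      by (rule tree_below_linear[OF T xyz(2)]) (use m xyz in blast)+
    then have "?a \<le> ?c \<or> ?b \<le> ?c"
    proof
      assume "?a \<le> ?b"
      then have "?a \<le> z" using m(3)[OF xyz(2,3)] by (rule order_trans)
      then show ?thesis
        using tree_meet_greatest[OF T xyz(1,3) m(1)[OF xyz(1,2)] m(2)[OF xyz(1,2)]] by blast
    next
      assume "?b \<le> ?a"
      then have "?b \<le> x" using m(2)[OF xyz(1,2)] by (rule order_trans)
      then show ?thesis
        using tree_meet_greatest[OF T xyz(1,3) m(1)[OF xyz(2,3)] _ m(3)[OF xyz(2,3)]] by blast
    qed
    then have "r ?c \<le> r ?a \<or> r ?c \<le> r ?b"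
      using anti[OF m(1)[OF xyz(1,2)] m(1)[OF xyz(1,3)]]
        anti[OF m(1)[OF xyz(2,3)] m(1)[OF xyz(1,3)]] by blast
    then show "tree_dist T \<Psi> x z \<le> tree_dist T \<Psi> x y + tree_dist T \<Psi> y z"
      using d[OF xyz(1,2)] d[OF xyz(2,3)] d[OF xyz(1,3)] bnd[OF xyz(1,2)] bnd[OF xyz(2,3)] by linarith
  qed
qed

end

theory Submission
  imports Defs
begin

text \<open>
  It suffices that every tangent vector at \<open>\<tau>\<close> is open for \<open>d\<^sub>\<Psi>\<close>, since tangent vectors form
  a subbase of the weak tree topology.  Two points lying in different tangent vectors at \<open>\<tau>\<close>
  are separated by \<open>\<tau>\<close>: the segment between them passes through \<open>\<tau>\<close>.  Moving from \<open>\<alpha>\<close> to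
  another tangent vector at \<open>\<tau>\<close> therefore costs at least \<open>d\<^sub>\<Psi>(\<alpha>, \<tau>)\<close>, so the ball of this
  radius around \<open>\<alpha>\<close> stays inside the tangent vector of \<open>\<alpha>\<close> (\<open>tangent_rel_of_tree_dist_less\<close>).

  The computation rests on an order-theoretic description of the tangent vectors at \<open>\<tau>\<close>
  (\<open>tangent_rel_iff\<close>): the points not above \<open>\<tau>\<close>, if there are any, form a single tangent
  vector, and two points strictly above \<open>\<tau>\<close> are equivalent exactly when they have a common
  lower bound strictly above \<open>\<tau>\<close>.
\<close>

text \<open>
  Along the segment from \<open>\<tau>\<close> to a point that is not above \<open>\<tau>\<close>, one first descends; any two such
  descents share the larger of the two meets, and nothing on such a segment is strictly above
  \<open>\<tau>\<close>.  The segment to a point above \<open>\<tau>\<close> only ascends, and so it can share a point other than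
  \<open>\<tau>\<close> only with another ascending segment.
\<close>

lemma tangent_rel_iff:
  assumes T: "rooted_nonmetric_tree T" and \<tau>: "\<tau> \<in> T"
  shows "(\<sigma>, \<alpha>) \<in> tangent_rel T \<tau> \<longleftrightarrow>
    \<sigma> \<in> T - {\<tau>} \<and> \<alpha> \<in> T - {\<tau>} \<and>
    (\<not> \<tau> \<le> \<sigma> \<and> \<not> \<tau> \<le> \<alpha> \<or> (\<exists>\<gamma>\<in>T. \<tau> < \<gamma> \<and> \<gamma> \<le> \<sigma> \<and> \<gamma> \<le> \<alpha>))"
proof (cases "\<sigma> \<in> T - {\<tau>} \<and> \<alpha> \<in> T - {\<tau>}")
  case True
  then have \<sigma>: "\<sigma> \<in> T" and \<alpha>: "\<alpha> \<in> T" by auto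
  let ?s = "tree_meet T \<tau> \<sigma>" and ?a = "tree_meet T \<tau> \<alpha>"
  note s = tree_meet_in[OF T \<tau> \<sigma>] and a = tree_meet_in[OF T \<tau> \<alpha>]
  have above: "\<tau> < \<gamma> \<and> \<gamma> \<le> \<xi>"
    if "\<xi> \<in> T" "\<tau> \<le> \<xi>" "\<gamma> \<in> tree_segment T \<tau> \<xi> - {\<tau>}" for \<xi> \<gamma>
    using that tree_meet_greatest[OF T \<tau> that(1) \<tau>]
    by (auto simp: tree_segment_def less_le intro: order_trans)
  have not_above: "\<not> \<tau> < \<gamma>"
    if "\<xi> \<in> T" "\<not> \<tau> \<le> \<xi>" "\<gamma> \<in> tree_segment T \<tau> \<xi>" for \<xi> \<gamma>
    using that by (force simp: tree_segment_def)
  have "(tree_segment T \<tau> \<sigma> - {\<tau>}) \<inter> (tree_segment T \<tau> \<alpha> - {\<tau>}) \<noteq> {} \<longleftrightarrow>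
    \<not> \<tau> \<le> \<sigma> \<and> \<not> \<tau> \<le> \<alpha> \<or> (\<exists>\<gamma>\<in>T. \<tau> < \<gamma> \<and> \<gamma> \<le> \<sigma> \<and> \<gamma> \<le> \<alpha>)" (is "?L \<longleftrightarrow> ?R")
  proof
    assume ?L
    then obtain \<gamma> where \<gamma>: "\<gamma> \<in> tree_segment T \<tau> \<sigma> - {\<tau>}" "\<gamma> \<in> tree_segment T \<tau> \<alpha> - {\<tau>}"
      by blast
    then have "\<gamma> \<in> T" by (simp add: tree_segment_def)
    then show ?R
      using \<gamma> above[OF \<sigma> _ \<gamma>(1)] above[OF \<alpha> _ \<gamma>(2)] not_above[OF \<sigma>] not_above[OF \<alpha>] by blast
  next
    assume ?R
    then show ?L
    proof
      assume n: "\<not> \<tau> \<le> \<sigma> \<and> \<not> \<tau> \<le> \<alpha>"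
      then have "?s \<noteq> \<tau>" "?a \<noteq> \<tau>" using s(3) a(3) by auto
      moreover have "?s \<le> ?a \<or> ?a \<le> ?s"
        by (rule tree_below_linear[OF T \<tau> s(1) a(1) s(2) a(2)])
      ultimately show ?L using s a by (auto simp: tree_segment_def)
    next
      assume "\<exists>\<gamma>\<in>T. \<tau> < \<gamma> \<and> \<gamma> \<le> \<sigma> \<and> \<gamma> \<le> \<alpha>"
      then obtain \<gamma> where "\<gamma> \<in> T" "\<tau> < \<gamma>" "\<gamma> \<le> \<sigma>" "\<gamma> \<le> \<alpha>" by blast
      moreover from this have "?s \<le> \<gamma>" "?a \<le> \<gamma>" using s(2) a(2) by auto
      ultimately show ?L by (auto simp: tree_segment_def)
    qed
  qed
  then show ?thesis using True by (simp add: tangent_rel_def)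
qed (auto simp: tangent_rel_def)

text \<open>
  Above \<open>\<tau>\<close>, the two common lower bounds both lie below the middle point, hence they are
  comparable, and the smaller one bounds the outer points.
\<close>

lemma trans_tangent_rel:
  assumes T: "rooted_nonmetric_tree T" and \<tau>: "\<tau> \<in> T"
  shows "trans (tangent_rel T \<tau>)"
proof (rule transI)
  fix x y z
  assume xy: "(x, y) \<in> tangent_rel T \<tau>" and yz: "(y, z) \<in> tangent_rel T \<tau>"
  show "(x, z) \<in> tangent_rel T \<tau>"
  proof (cases "\<tau> \<le> y")
    case True
    with xy yz obtain c d where c: "c \<in> T" "\<tau> < c" "c \<le> x" "c \<le> y"
      and d: "d \<in> T" "\<tau> < d" "d \<le> y" "d \<le> z" and "y \<in> T"
      unfolding tangent_rel_iff[OF T \<tau>] by blast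
    then have "c \<le> d \<or> d \<le> c" by (intro tree_below_linear[OF T])
    then have "\<exists>e\<in>T. \<tau> < e \<and> e \<le> x \<and> e \<le> z" using c d by (meson order_trans)
    then show ?thesis using xy yz unfolding tangent_rel_iff[OF T \<tau>] by blast
  next
    case False
    then have "\<not> \<tau> \<le> x \<and> \<not> \<tau> \<le> z"
      using xy yz unfolding tangent_rel_iff[OF T \<tau>] by (meson less_imp_le order_trans)
    then show ?thesis using xy yz unfolding tangent_rel_iff[OF T \<tau>] by blast
  qed
qed

text \<open>
  Write \<open>r = 1 / \<Psi>\<close>, which decreases along the tree.  If \<open>\<alpha>\<close> lies above \<open>\<tau>\<close>, the distance from
  \<open>\<alpha>\<close> to \<open>\<beta>\<close> is at least the height of the descent from \<open>\<alpha>\<close> to the meet of \<open>\<alpha>\<close> and \<open>\<beta>\<close>; the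
  hypothesis stops that descent before \<open>\<tau>\<close>.  If \<open>\<alpha>\<close> is not above \<open>\<tau>\<close> but \<open>\<beta>\<close> is, then \<open>\<alpha>\<close> has
  the same meet with \<open>\<beta>\<close> as with \<open>\<tau>\<close>, and \<open>\<beta>\<close> is at least as far away as \<open>\<tau>\<close>.
\<close>

lemma tangent_rel_of_tree_dist_less:
  assumes T: "rooted_nonmetric_tree T" and P: "parametrization T \<Psi>" and ge1: "\<Psi> ` T \<subseteq> {1..\<infinity>}"
    and \<tau>: "\<tau> \<in> T" and \<alpha>: "\<alpha> \<in> T" and \<beta>: "\<beta> \<in> T" and "\<alpha> \<noteq> \<tau>"
    and less: "tree_dist T \<Psi> \<alpha> \<beta> < tree_dist T \<Psi> \<alpha> \<tau>"
  shows "(\<alpha>, \<beta>) \<in> tangent_rel T \<tau>"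
proof -
  define r where "r \<equiv> \<lambda>x. real_of_ereal (1 / \<Psi> x)"
  let ?b = "tree_meet T \<alpha> \<beta>" and ?t = "tree_meet T \<alpha> \<tau>"
  note b = tree_meet_in[OF T \<alpha> \<beta>] and t = tree_meet_in[OF T \<alpha> \<tau>]
  have anti: "r y \<le> r x" if "x \<in> T" "y \<in> T" "x \<le> y" for x y
    unfolding r_def using that ge1 P
    by (intro ereal_inverse_antimono_ge1) (auto simp: parametrization_def mono_on_def)
  have less': "2 * r ?b - r \<beta> < 2 * r ?t - r \<tau>"
    using less tree_dist_eq[OF T ge1 \<alpha> \<beta>] tree_dist_eq[OF T ge1 \<alpha> \<tau>] by (simp add: r_def)
  have "\<beta> \<noteq> \<tau>" using less by blast
  moreover have "\<not> \<tau> \<le> \<alpha> \<and> \<not> \<tau> \<le> \<beta> \<or> (\<exists>\<gamma>\<in>T. \<tau> < \<gamma> \<and> \<gamma> \<le> \<alpha> \<and> \<gamma> \<le> \<beta>)"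
  proof (cases "\<tau> \<le> \<alpha>")
    case True
    then have "?t = \<tau>" using t(3) tree_meet_greatest[OF T \<alpha> \<tau> \<tau>] by (simp add: order_antisym)
    then have "r ?b < r \<tau>" using less' anti[OF b(1) \<beta> b(3)] by simp
    then have "\<not> ?b \<le> \<tau>" using anti[OF b(1) \<tau>] by linarith
    moreover have "?b \<le> \<tau> \<or> \<tau> \<le> ?b" by (rule tree_below_linear[OF T \<alpha> b(1) \<tau> b(2) True])
    ultimately have "\<tau> < ?b" by (simp add: less_le_not_le)
    then show ?thesis using b by blast
  next
    case False
    have "\<not> \<tau> \<le> \<beta>"
    proof
      assume le: "\<tau> \<le> \<beta>"
      have "?b \<le> \<tau> \<or> \<tau> \<le> ?b" by (rule tree_below_linear[OF T \<beta> b(1) \<tau> b(3) le])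
      then have "?b \<le> \<tau>" using False b(2) order_trans by blast
      then have "?b \<le> ?t" by (rule tree_meet_greatest[OF T \<alpha> \<tau> b(1,2)])
      then show False using anti[OF b(1) t(1)] anti[OF \<tau> \<beta> le] less' by linarith
    qed
    with False show ?thesis by blast
  qed
  ultimately show ?thesis using \<alpha> \<beta> \<open>\<alpha> \<noteq> \<tau>\<close> by (simp add: tangent_rel_iff[OF T \<tau>])
qed

lemma openin_tangent_vector:
  assumes T: "rooted_nonmetric_tree T" and P: "parametrization T \<Psi>" and ge1: "\<Psi> ` T \<subseteq> {1..\<infinity>}"
    and \<tau>: "\<tau> \<in> T"
  shows "openin (Metric_space.mtopology T (tree_dist T \<Psi>)) (tangent_vector T \<tau> \<sigma>)"
proof -
  interpret Metric_space T "tree_dist T \<Psi>" by (rule Metric_space_tree_dist[OF T P ge1])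
  show ?thesis unfolding openin_mtopology
  proof (intro conjI allI impI)
    show "tangent_vector T \<tau> \<sigma> \<subseteq> T" by (auto simp: tangent_vector_def tangent_rel_def)
    fix \<alpha> assume "\<alpha> \<in> tangent_vector T \<tau> \<sigma>"
    then have rel: "(\<sigma>, \<alpha>) \<in> tangent_rel T \<tau>" by (simp add: tangent_vector_def)
    then have \<alpha>: "\<alpha> \<in> T" "\<alpha> \<noteq> \<tau>" by (auto simp: tangent_rel_def)
    have "mball \<alpha> (tree_dist T \<Psi> \<alpha> \<tau>) \<subseteq> tangent_vector T \<tau> \<sigma>"
    proof
      fix \<beta> assume "\<beta> \<in> mball \<alpha> (tree_dist T \<Psi> \<alpha> \<tau>)"
      then have "(\<alpha>, \<beta>) \<in> tangent_rel T \<tau>"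
        using tangent_rel_of_tree_dist_less[OF T P ge1 \<tau> \<alpha>(1) _ \<alpha>(2)] by simp
      with rel show "\<beta> \<in> tangent_vector T \<tau> \<sigma>"
        using trans_tangent_rel[OF T \<tau>] unfolding tangent_vector_def by (blast dest: transD)
    qed
    moreover have "0 < tree_dist T \<Psi> \<alpha> \<tau>" using \<alpha> \<tau> by simp
    ultimately show "\<exists>e>0. mball \<alpha> e \<subseteq> tangent_vector T \<tau> \<sigma>" by blast
  qed
qed

theorem theorem1p2:
  fixes T :: "'a::order set" and \<Psi> :: "'a \<Rightarrow> ereal"
  assumes "rooted_nonmetric_tree T"
    and "parametrization T \<Psi>"
    and "\<Psi> ` T \<subseteq> {1..\<infinity>}"
  shows "\<forall>U. openin (weak_tree_topology T) U \<longrightarrow>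
             openin (Metric_space.mtopology T (tree_dist T \<Psi>)) U"
proof (intro allI impI)
  fix U assume U: "openin (weak_tree_topology T) U"
  interpret Metric_space T "tree_dist T \<Psi>" by (rule Metric_space_tree_dist[OF assms])
  have "openin mtopology T" using openin_topspace[of mtopology] by simp
  then show "openin mtopology U"
    using openin_tangent_vector[OF assms] U unfolding weak_tree_topology_def
    by (elim minimal_topology_subbase[rotated 2]) auto
qed

end
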